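(* Let $m(z)=\begin{pmatrix}a&b\\c&d\end{pmatrix}(z):=\dfrac{az+b}{cz+d}$ be a Möbius transformation with complex coefficients $a,b,c,d$. If $\Delta:=\sqrt{|ad-bc|}$, then the Poincaré extension of $m$, acting on the spheres $S_{\alpha,\beta}$ ($\alpha,\beta\in\mathbb C$), is given by $$\begin{pmatrix}a&b\\c&d\end{pmatrix}(S_{\alpha,\beta})=S_{(a\alpha+b\beta)/\Delta,\ (c\alpha+d\beta)/\Delta}.$$
   Context: Identify $\mathbb R^3$ with $\mathbb C\times\mathbb R$. For $z\in\mathbb C$ and $r>0$, $S(z,r)$ is the sphere with center $(z,r)$ and radius $r$, which lies above and is tangent to the complex plane at $z$; such spheres are called normal. For $\alpha,\beta\in\mathbb C$, $S_{\alpha,\beta}:=S\left(\frac{\alpha}{\beta},\frac1{2|\beta|^2}\right)$, where $S_{1,0}$ is interpreted as the plane parallel to, and one unit above, $\mathbb C$. The Poincaré extension of a Möbius transformation $m$ is its unique sphere-preserving continuous extension to $\mathbb C\times[0,\infty)$; it acts on normal spheres by $S(z,r)\mapsto S(m(z),|m'(z)|r)$, and the same symbol (the matrix) is used for the transformation and its extension. *)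

theory Defs
  imports "HOL-Analysis.Analysis"
begin

text \<open>
  Points of the extended space are options: \<open>Some (z, t)\<close> is the point of height \<open>t\<close> over
  \<open>z\<close> in \<open>\<complex> \<times> \<real>\<close>, and \<open>None\<close> is the point at infinity.  The norm and the inner product on
  \<^typ>\<open>complex \<times> real\<close> are the Euclidean ones.
\<close>

definition ext_space :: "(complex \<times> real) option topology" where
  "ext_space = Alexandroff_compactification euclidean"

definition upper_half_space :: "(complex \<times> real) option set" where
  "upper_half_space = insert None (Some ` {p. 0 \<le> snd p})"

definition boundary_point :: "complex option \<Rightarrow> (complex \<times> real) option" where
  "boundary_point = map_option (\<lambda>z. (z, 0))"

text \<open>Planes, completed by the point at infinity, count as spheres.\<close>

definition is_sphere :: "(complex \<times> real) option set \<Rightarrow> bool" where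
  "is_sphere \<Sigma> \<longleftrightarrow>
     (\<exists>p r. 0 < r \<and> \<Sigma> = Some ` sphere p r) \<or>
     (\<exists>n k. n \<noteq> 0 \<and> \<Sigma> = insert None (Some ` {x. n \<bullet> x = k}))"

definition moebius :: "complex \<Rightarrow> complex \<Rightarrow> complex \<Rightarrow> complex \<Rightarrow> complex option \<Rightarrow> complex option" where
  "moebius a b c d w =
     (case w of
        None \<Rightarrow> if c = 0 then None else Some (a / c)
      | Some z \<Rightarrow> if c * z + d = 0 then None else Some ((a * z + b) / (c * z + d)))"

definition is_poincare_extension ::
  "(complex option \<Rightarrow> complex option) \<Rightarrow> ((complex \<times> real) option \<Rightarrow> (complex \<times> real) option) \<Rightarrow> bool"
where
  "is_poincare_extension m F \<longleftrightarrow>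
     continuous_map (subtopology ext_space upper_half_space)
                    (subtopology ext_space upper_half_space) F \<and>
     (\<forall>w. F (boundary_point w) = boundary_point (m w)) \<and>
     (\<forall>\<Sigma>. is_sphere \<Sigma> \<and> \<Sigma> \<subseteq> upper_half_space \<longrightarrow> is_sphere (F ` \<Sigma>))"

text \<open>
  Functions are total, so the extension is normalised to be \<^const>\<open>undefined\<close> outside the closed
  upper half-space; otherwise it could not be unique.
\<close>

definition poincare_extension ::
  "(complex option \<Rightarrow> complex option) \<Rightarrow> (complex \<times> real) option \<Rightarrow> (complex \<times> real) option"
where
  "poincare_extension m =
     (THE F. F \<in> extensional upper_half_space \<and> is_poincare_extension m F)"

definition normal_sphere :: "complex \<Rightarrow> real \<Rightarrow> (complex \<times> real) option set" where
  "normal_sphere z r = Some ` sphere (z, r) r"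

text \<open>
  For \<open>\<beta> = 0\<close> the sphere is the horizontal plane of height \<open>\<bar>\<alpha>\<bar>\<^sup>2\<close>, so one unit above \<open>\<complex>\<close> when
  \<open>\<alpha> = 1\<close>.  This is the limit as \<open>\<beta> \<rightarrow> 0\<close>: for \<open>\<beta> \<noteq> 0\<close> the sphere has the equation
  \<open>\<bar>\<beta> z - \<alpha>\<bar>\<^sup>2 + \<bar>\<beta>\<bar>\<^sup>2 t\<^sup>2 = t\<close>.  In the degenerate case \<open>\<alpha> = \<beta> = 0\<close> it is the boundary plane.
\<close>

definition S_sphere :: "complex \<Rightarrow> complex \<Rightarrow> (complex \<times> real) option set" where
  "S_sphere \<alpha> \<beta> =
     (if \<beta> = 0 then insert None (Some ` {p. snd p = (cmod \<alpha>)\<^sup>2})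
      else normal_sphere (\<alpha> / \<beta>) (1 / (2 * (cmod \<beta>)\<^sup>2)))"

end

theory Submission
  imports Defs
begin

text \<open>
  A Moebius transformation is either affine or a composition of an affine map, the inversion
  \<open>z \<mapsto> 1 / z\<close> and another affine map.  For these generators a sphere-preserving continuous
  extension to the closed half-space can be written down: affine maps extend to similarities
  (\<open>similarity_ext\<close>), and the inversion extends to \<open>(z, t) \<mapsto> (cnj z, t) / (\<bar>z\<bar>\<^sup>2 + t\<^sup>2)\<close>
  (\<open>inversion_ext\<close>).  In the equation \<open>\<bar>\<beta> z - \<alpha>\<bar>\<^sup>2 + \<bar>\<beta>\<bar>\<^sup>2 t\<^sup>2 = t\<close> of a sphere, a similarity
  applies its matrix to \<open>(\<alpha>, \<beta>)\<close>, normalised by the root of the modulus of its determinant, and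
  the inversion swaps \<open>\<alpha>\<close> and \<open>\<beta>\<close> (\<open>similarity_ext_S_sphere\<close>, \<open>inversion_ext_S_sphere\<close>).
  Determinants being multiplicative, the formula follows for all matrices.

  The Poincare extension is defined by a description, so these maps compute it only once an
  extension is known to be unique.  Composing with the inverse reduces this to the claim that an
  extension \<open>F\<close> of the identity is the identity (\<open>eq_id\<close>), where \<open>F\<close> is not known to be injective.
  Every normal sphere based at \<open>w\<close> is mapped to a sphere through \<open>w\<close>, that is, to a normal sphere
  based at \<open>w\<close> or to the boundary plane; similarly horizontal planes are mapped to horizontal
  planes.  First, no interior point is mapped into the boundary plane: the collapse of one point
  would spread along normal spheres and reach every height, but planes near infinity stay near
  infinity (\<open>interior_to_interior\<close>).  Second, \<open>F\<close> restricted to a horizontal plane sends every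
  circle into a concentric circle and is onto a horizontal plane, and the only such map of the
  plane is the identity (\<open>concentric_circle_map_is_id\<close>).  So \<open>F\<close> has the form
  \<open>(z, t) \<mapsto> (z, \<psi> t)\<close>.  Third, normal spheres based at \<open>0\<close> yield
  \<open>\<psi> s (\<psi> t - \<psi> s) = s (t - s)\<close> for \<open>s \<le> t\<close>, and with \<open>\<psi> t \<rightarrow> 0\<close> as \<open>t \<rightarrow> 0\<close> this forces
  \<open>\<psi> t = t\<close> (\<open>height_function_is_id\<close>).
\<close>

section \<open>Neighbourhoods in the extended space\<close>

lemma mem_upper_half_space [simp]:
  "None \<in> upper_half_space"
  "Some x \<in> upper_half_space \<longleftrightarrow> 0 \<le> snd x"
  by (auto simp: upper_half_space_def)

text \<open>
  Openness in the compactification, reduced to the filter \<^const>\<open>at_infinity\<close>: continuity of a map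
  at and onto the point at infinity then becomes a limit statement on \<open>\<complex> \<times> \<real>\<close>.
\<close>

lemma openin_ext_space_iff:
  "openin ext_space U \<longleftrightarrow>
     open {x. Some x \<in> U} \<and> (None \<in> U \<longrightarrow> (\<forall>\<^sub>F x in at_infinity. Some x \<in> U))"
proof (cases "None \<in> U")
  case False
  then have U: "U = Some ` {x. Some x \<in> U}"
  proof (intro set_eqI)
    fix p show "p \<in> U \<longleftrightarrow> p \<in> Some ` {x. Some x \<in> U}" using False by (cases p) auto
  qed
  have "openin ext_space U \<longleftrightarrow> open {x. Some x \<in> U}"
  proof
    assume "openin ext_space U"
    then obtain V where "open V" "U = Some ` V"
      using False by (auto simp: ext_space_def openin_Alexandroff_compactification)
    then show "open {x. Some x \<in> U}" by (simp add: image_iff)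
  next
    assume "open {x. Some x \<in> U}"
    then show "openin ext_space U"
      using U by (auto simp: ext_space_def openin_Alexandroff_compactification)
  qed
  then show ?thesis using False by simp
next
  case True
  define V where "V = {x. Some x \<in> U}"
  have U: "U = insert None (Some ` V)"
  proof (intro set_eqI)
    fix p show "p \<in> U \<longleftrightarrow> p \<in> insert None (Some ` V)"
      using True by (cases p) (auto simp: V_def)
  qed
  have "openin ext_space U \<longleftrightarrow> compact (- V)"
  proof
    assume "openin ext_space U"
    then obtain C where "compact C" "U = insert None (Some ` (- C))"
      using True by (auto simp: ext_space_def openin_Alexandroff_compactification Compl_eq_Diff_UNIV)
    then have "C = - V" by (simp add: V_def image_iff set_eq_iff)
    with \<open>compact C\<close> show "compact (- V)" by simp
  next
    assume "compact (- V)"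
    then show "openin ext_space U"
      unfolding ext_space_def openin_Alexandroff_compactification using U
      by (intro disjI2 exI[of _ "- V"]) (auto simp: compact_imp_closed)
  qed
  also have "\<dots> \<longleftrightarrow> open V \<and> bounded (- V)"
    by (auto simp: compact_eq_bounded_closed open_closed)
  also have "bounded (- V) \<longleftrightarrow> (\<forall>\<^sub>F x in at_infinity. x \<in> V)"
  proof -
    have "bounded (- V) \<longleftrightarrow> (\<exists>b. \<forall>x. b \<le> norm x \<longrightarrow> x \<in> V)"
      unfolding bounded_iff
      by (metis ComplD ComplI gt_ex leD linear order_less_le_trans not_le)
    then show ?thesis by (simp add: eventually_at_infinity)
  qed
  finally show ?thesis using True by (simp add: V_def)
qed

lemma topspace_ext_space [simp]: "topspace ext_space = UNIV"
  by (auto simp: ext_space_def UNIV_option_conv)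

text \<open>
  The explicit maps used below are continuous on the whole extended space, so that their continuity
  on the closed half-space can be read off from preimages in the ambient topology.
\<close>

lemma continuous_map_ext_spaceI:
  assumes "\<And>U. openin ext_space U \<Longrightarrow> openin ext_space {p. F p \<in> U}"
    and "F \<in> upper_half_space \<rightarrow> upper_half_space"
  shows "continuous_map (subtopology ext_space upper_half_space)
           (subtopology ext_space upper_half_space) F"
proof -
  have "continuous_map ext_space ext_space F"
    using assms(1) by (auto simp: continuous_map_def)
  then show ?thesis
    using assms(2) by (auto simp: continuous_map_in_subtopology continuous_map_from_subtopology)
qed

section \<open>Spheres and planes as one family of quadrics\<close>

text \<open>
  Spheres (\<open>A \<noteq> 0\<close>) and planes (\<open>A = 0\<close>) in one equation.  Inversion exchanges the two outer
  coefficients, which is why spheres and planes need not be told apart.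
\<close>

definition quadric :: "real \<Rightarrow> complex \<times> real \<Rightarrow> real \<Rightarrow> (complex \<times> real) option set" where
  "quadric A u B =
     Some ` {x. A * (x \<bullet> x) + u \<bullet> x + B = 0} \<union> (if A = 0 then {None} else {})"

lemma mem_quadric [simp]:
  "None \<in> quadric A u B \<longleftrightarrow> A = 0"
  "Some x \<in> quadric A u B \<longleftrightarrow> A * (x \<bullet> x) + u \<bullet> x + B = 0"
  by (auto simp: quadric_def)

text \<open>
  For \<open>A \<noteq> 0\<close>, completing the square shows that the inequality makes the squared radius positive;
  for \<open>A = 0\<close>, it says that the normal vector is nonzero.
\<close>

lemma is_sphere_iff_quadric:
  "is_sphere \<Sigma> \<longleftrightarrow> (\<exists>A u B. 4 * A * B < u \<bullet> u \<and> \<Sigma> = quadric A u B)"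
proof
  assume "is_sphere \<Sigma>"
  then consider p r where "0 < r" "\<Sigma> = Some ` sphere p r"
    | n k where "n \<noteq> 0" "\<Sigma> = insert None (Some ` {x. n \<bullet> x = k})"
    unfolding is_sphere_def by blast
  then show "\<exists>A u B. 4 * A * B < u \<bullet> u \<and> \<Sigma> = quadric A u B"
  proof cases
    case 1
    have "x \<in> sphere p r \<longleftrightarrow> x \<bullet> x + (- 2 *\<^sub>R p) \<bullet> x + (p \<bullet> p - r\<^sup>2) = 0" for x
    proof -
      have "x \<in> sphere p r \<longleftrightarrow> (norm (x - p))\<^sup>2 = r\<^sup>2"
        using 1 by (auto simp: dist_norm norm_minus_commute)
      also have "(norm (x - p))\<^sup>2 = x \<bullet> x - 2 * (p \<bullet> x) + p \<bullet> p"
        by (simp add: power2_norm_eq_inner inner_diff_left inner_diff_right inner_commute)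
      finally show ?thesis by (auto simp: inner_commute)
    qed
    then have "\<Sigma> = quadric 1 (- 2 *\<^sub>R p) (p \<bullet> p - r\<^sup>2)"
      using 1 by (auto simp: quadric_def)
    moreover have "4 * 1 * (p \<bullet> p - r\<^sup>2) < (- 2 *\<^sub>R p) \<bullet> (- 2 *\<^sub>R p)"
      using 1 by (simp add: right_diff_distrib)
    ultimately show ?thesis by blast
  next
    case 2
    then have "\<Sigma> = quadric 0 n (- k)" by (auto simp: quadric_def)
    moreover have "4 * 0 * (- k) < n \<bullet> n" using 2 by simp
    ultimately show ?thesis by blast
  qed
next
  assume "\<exists>A u B. 4 * A * B < u \<bullet> u \<and> \<Sigma> = quadric A u B"
  then obtain A u B where AB: "4 * A * B < u \<bullet> u" and S: "\<Sigma> = quadric A u B" by blast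
  show "is_sphere \<Sigma>"
  proof (cases "A = 0")
    case True
    then have "u \<noteq> 0" using AB by auto
    moreover have "\<Sigma> = insert None (Some ` {x. u \<bullet> x = - B})"
      using S True by (auto simp: quadric_def image_iff)
    ultimately show ?thesis unfolding is_sphere_def by blast
  next
    case False
    define p where "p = (- 1 / (2 * A)) *\<^sub>R u"
    define r where "r = sqrt ((u \<bullet> u - 4 * A * B) / (4 * A\<^sup>2))"
    have r: "0 < r" "r\<^sup>2 = (u \<bullet> u - 4 * A * B) / (4 * A\<^sup>2)"
      using AB False by (auto simp: r_def)
    have "x \<in> sphere p r \<longleftrightarrow> A * (x \<bullet> x) + u \<bullet> x + B = 0" for x
    proof -
      have "x \<in> sphere p r \<longleftrightarrow> (norm (x - p))\<^sup>2 = r\<^sup>2"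
        using r(1) by (auto simp: dist_norm norm_minus_commute)
      also have "(norm (x - p))\<^sup>2 = x \<bullet> x + (u \<bullet> x) / A + (u \<bullet> u) / (4 * A\<^sup>2)"
      proof -
        have "(norm (x - p))\<^sup>2 = x \<bullet> x - 2 * (p \<bullet> x) + p \<bullet> p"
          by (simp add: power2_norm_eq_inner inner_diff_left inner_diff_right inner_commute)
        then show ?thesis using False by (simp add: p_def power2_eq_square)
      qed
      also have "\<dots> = r\<^sup>2 + (A * (x \<bullet> x) + u \<bullet> x + B) / A"
        unfolding r(2) using False by (simp add: add_divide_distrib diff_divide_distrib power2_eq_square)
      also have "\<dots> = r\<^sup>2 \<longleftrightarrow> A * (x \<bullet> x) + u \<bullet> x + B = 0"
        using False by simp
      finally show ?thesis .
    qed
    then have "\<Sigma> = Some ` sphere p r" using S False by (auto simp: quadric_def)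
    then show ?thesis using r unfolding is_sphere_def by blast
  qed
qed

section \<open>The extension of the inversion\<close>

text \<open>
  Since \<open>1 / z = cnj z / \<bar>z\<bar>\<^sup>2\<close>, the extension of \<open>z \<mapsto> 1 / z\<close> is inversion in the unit sphere
  composed with the reflection that conjugates the horizontal coordinate.
\<close>

definition hconj :: "complex \<times> real \<Rightarrow> complex \<times> real" where
  "hconj x = (cnj (fst x), snd x)"

lemma inner_hconj_hconj [simp]: "hconj x \<bullet> hconj y = x \<bullet> y"
  by (simp add: hconj_def inner_prod_def inner_complex_def)

lemma norm_hconj [simp]: "norm (hconj x) = norm x"
  by (simp add: norm_eq_sqrt_inner)

lemma hconj_hconj [simp]: "hconj (hconj x) = x"
  by (simp add: hconj_def)

lemma hconj_scaleR [simp]: "hconj (r *\<^sub>R x) = r *\<^sub>R hconj x"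
  by (simp add: hconj_def prod_eq_iff)

lemma hconj_eq_0_iff [simp]: "hconj x = 0 \<longleftrightarrow> x = 0"
  by (metis norm_eq_zero norm_hconj)

definition inversion_ext :: "(complex \<times> real) option \<Rightarrow> (complex \<times> real) option" where
  "inversion_ext p =
     (case p of
        None \<Rightarrow> Some 0
      | Some x \<Rightarrow> if x = 0 then None else Some (hconj x /\<^sub>R (x \<bullet> x)))"

lemma inversion_ext_simps:
  "inversion_ext None = Some 0"
  "inversion_ext (Some 0) = None"
  "x \<noteq> 0 \<Longrightarrow> inversion_ext (Some x) = Some (hconj x /\<^sub>R (x \<bullet> x))"
  by (auto simp: inversion_ext_def)

lemma inversion_ext_involution [simp]: "inversion_ext (inversion_ext p) = p"
proof (cases p)
  case (Some x)
  then show ?thesis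
    by (cases "x = 0") (simp_all add: inversion_ext_simps)
qed (simp add: inversion_ext_simps)

lemma image_eq_of_mem_iff:
  assumes "\<And>q. G (G' q) = q" and "\<And>p. G p \<in> B \<longleftrightarrow> p \<in> A"
  shows "G ` A = B"
proof (intro set_eqI iffI)
  fix q assume "q \<in> B"
  then have "G' q \<in> A" using assms(2)[of "G' q"] assms(1) by simp
  then show "q \<in> G ` A" using assms(1)[of q] by (metis imageI)
qed (use assms(2) in auto)

lemma inversion_ext_quadric:
  "inversion_ext ` quadric A u B = quadric B (hconj u) A"
proof (rule image_eq_of_mem_iff[where G' = inversion_ext])
  fix p
  show "inversion_ext p \<in> quadric B (hconj u) A \<longleftrightarrow> p \<in> quadric A u B"
  proof (cases p)
    case None then show ?thesis by (simp add: inversion_ext_simps)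
  next
    case (Some x)
    show ?thesis
    proof (cases "x = 0")
      case True then show ?thesis using Some by (simp add: inversion_ext_simps)
    next
      case False
      have "B * inverse N + inverse N * k + A = 0 \<longleftrightarrow> A * N + k + B = 0" if "N \<noteq> 0" for N k
        using that by (simp add: field_simps)
      from this[of "x \<bullet> x" "u \<bullet> x"] False
      have "B * inverse (x \<bullet> x) + inverse (x \<bullet> x) * (u \<bullet> x) + A = 0
          \<longleftrightarrow> A * (x \<bullet> x) + u \<bullet> x + B = 0"
        by simp
      then show ?thesis using Some False by (simp add: inversion_ext_simps)
    qed
  qed
qed simp

lemma is_sphere_inversion_ext: "is_sphere \<Sigma> \<Longrightarrow> is_sphere (inversion_ext ` \<Sigma>)"
  unfolding is_sphere_iff_quadric
proof (elim exE conjE)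
  fix A u B assume "4 * A * B < u \<bullet> u" "\<Sigma> = quadric A u B"
  then have "4 * B * A < hconj u \<bullet> hconj u \<and> inversion_ext ` \<Sigma> = quadric B (hconj u) A"
    by (simp add: inversion_ext_quadric mult.commute mult.left_commute)
  then show "\<exists>A u B. 4 * A * B < u \<bullet> u \<and> inversion_ext ` \<Sigma> = quadric A u B" by blast
qed

text \<open>
  Since \<open>\<bar>hconj x / \<bar>x\<bar>\<^sup>2\<bar> = 1 / \<bar>x\<bar>\<close>, the map tends to infinity at \<open>0\<close> and to \<open>0\<close> at infinity.
\<close>

lemma inversion_ext_continuous:
  assumes U: "openin ext_space U" shows "openin ext_space {p. inversion_ext p \<in> U}"
proof -
  let ?j = "\<lambda>x. hconj x /\<^sub>R (x \<bullet> x)"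
  have nrm: "norm (?j x) = inverse (norm x)" for x
    by (simp add: power2_norm_eq_inner[symmetric] power2_eq_square divide_simps)
  have V: "open {x. Some x \<in> U}" "None \<in> U \<Longrightarrow> \<forall>\<^sub>F x in at_infinity. Some x \<in> U"
    using U by (auto simp: openin_ext_space_iff)
  have nhds: "\<forall>\<^sub>F y in nhds x. inversion_ext (Some y) \<in> U"
    if x: "inversion_ext (Some x) \<in> U" for x
  proof (cases "x = 0")
    case True
    then have N: "None \<in> U" using x by (simp add: inversion_ext_def)
    have "filterlim ?j at_infinity (at 0)"
      unfolding filterlim_at_infinity_conv_norm_at_top nrm
      by (intro filterlim_inverse_at_top tendsto_norm_zero tendsto_ident_at)
         (simp add: eventually_at_filter)
    then have "\<forall>\<^sub>F y in at 0. Some (?j y) \<in> U"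
      using V(2)[OF N] by (auto simp: filterlim_iff)
    then have "\<forall>\<^sub>F y in at 0. inversion_ext (Some y) \<in> U"
      by (simp add: eventually_at_filter inversion_ext_def)
    then show ?thesis using x True by (simp add: eventually_nhds_conv_at)
  next
    case False
    have "isCont ?j x" using False unfolding hconj_def by (intro continuous_intros) auto
    then have "filterlim ?j (nhds (?j x)) (nhds x)"
      unfolding isCont_def by (rule tendsto_at_iff_tendsto_nhds[where g = ?j, THEN iffD1])
    moreover have "\<forall>\<^sub>F y in nhds (?j x). Some y \<in> U"
      using V(1) x False by (auto simp: eventually_nhds inversion_ext_def)
    ultimately have "\<forall>\<^sub>F y in nhds x. Some (?j y) \<in> U" by (auto simp: filterlim_iff)
    moreover have "\<forall>\<^sub>F y in nhds x. y \<noteq> 0" using False by (rule t1_space_nhds)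
    ultimately show ?thesis by eventually_elim (simp add: inversion_ext_def)
  qed
  have inf: "\<forall>\<^sub>F x in at_infinity. inversion_ext (Some x) \<in> U" if "Some 0 \<in> U"
  proof -
    have "filterlim ?j (nhds 0) at_infinity"
      unfolding tendsto_norm_zero_iff[symmetric, of ?j] nrm
      by (intro tendsto_inverse_0_at_top filterlim_norm_at_top)
    moreover have "\<forall>\<^sub>F y in nhds 0. Some y \<in> U"
      using V(1) that by (auto simp: eventually_nhds)
    ultimately have "\<forall>\<^sub>F y in at_infinity. Some (?j y) \<in> U" by (auto simp: filterlim_iff)
    moreover have "\<forall>\<^sub>F y::complex \<times> real in at_infinity. y \<noteq> 0"
      by (rule eventually_not_equal_at_infinity)
    ultimately show ?thesis by eventually_elim (simp add: inversion_ext_def)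
  qed
  have "open {x. inversion_ext (Some x) \<in> U}"
  proof (subst open_subopen, intro ballI)
    fix x assume "x \<in> {x. inversion_ext (Some x) \<in> U}"
    then show "\<exists>T. open T \<and> x \<in> T \<and> T \<subseteq> {x. inversion_ext (Some x) \<in> U}"
      using nhds[of x] unfolding eventually_nhds by blast
  qed
  then show ?thesis
    unfolding openin_ext_space_iff mem_Collect_eq inversion_ext_simps(1) using inf by blast
qed

lemma is_poincare_extension_inversion_ext:
  "is_poincare_extension (moebius 0 1 1 0) inversion_ext"
  unfolding is_poincare_extension_def
proof (intro conjI allI impI)
  have "inversion_ext p \<in> upper_half_space" if "p \<in> upper_half_space" for p
  proof (cases p)
    case (Some x)
    then show ?thesis
      using that by (cases "x = 0") (simp_all add: inversion_ext_simps hconj_def)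
  qed (simp add: inversion_ext_simps)
  then show "continuous_map (subtopology ext_space upper_half_space)
           (subtopology ext_space upper_half_space) inversion_ext"
    by (intro continuous_map_ext_spaceI inversion_ext_continuous) auto
  show "inversion_ext (boundary_point w) = boundary_point (moebius 0 1 1 0 w)" for w
  proof (cases w)
    case (Some z)
    have "cnj z /\<^sub>R (z \<bullet> z) = 1 / z"
      unfolding complex_div_cnj[of 1 z]
      by (simp add: scaleR_conv_of_real dot_square_norm divide_inverse mult.commute)
    then show ?thesis using Some
      by (auto simp: inversion_ext_def hconj_def boundary_point_def moebius_def inner_prod_def
          zero_prod_def)
  qed (simp add: inversion_ext_def boundary_point_def moebius_def zero_prod_def)
qed (auto intro: is_sphere_inversion_ext)

section \<open>The extension of affine maps\<close>

text \<open>
  The horizontal map \<open>z \<mapsto> (a z + b) / d\<close> scales lengths by \<open>\<bar>a / d\<bar>\<close>; scaling heights by the same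
  factor makes a similarity of space.
\<close>

definition similarity_ext ::
  "complex \<Rightarrow> complex \<Rightarrow> complex \<Rightarrow> (complex \<times> real) option \<Rightarrow> (complex \<times> real) option" where
  "similarity_ext a b d = map_option (\<lambda>x. ((a * fst x + b) / d, cmod (a / d) * snd x))"

lemma similarity_ext_inverse:
  assumes "a \<noteq> 0" "d \<noteq> 0"
  shows "similarity_ext d (- b) a (similarity_ext a b d p) = p"
  using assms by (cases p) (auto simp: similarity_ext_def norm_divide)

text \<open>
  Planes are the loci of points equidistant from two points.  In this form it is evident that
  similarities preserve them.
\<close>

lemma equidistant_eq_plane:
  fixes p q :: "'a::real_inner"
  shows "{x. dist x p = dist x q} = {x. (q - p) \<bullet> x = (q \<bullet> q - p \<bullet> p) / 2}"
proof -
  have expand: "(x - y) \<bullet> (x - y) = x \<bullet> x - 2 * (y \<bullet> x) + y \<bullet> y" for x y :: 'a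
    by (simp add: inner_diff_left inner_diff_right inner_commute)
  have "dist x p = dist x q \<longleftrightarrow> (x - p) \<bullet> (x - p) = (x - q) \<bullet> (x - q)" for x
    by (simp add: dist_norm norm_eq)
  also have "\<dots> x \<longleftrightarrow> (q - p) \<bullet> x = (q \<bullet> q - p \<bullet> p) / 2" for x
    unfolding expand by (auto simp: inner_diff_left)
  finally show ?thesis by simp
qed

lemma plane_eq_equidistant:
  fixes n :: "'a::real_inner"
  assumes "n \<noteq> 0"
  obtains p q where "p \<noteq> q" "{x. n \<bullet> x = k} = {x. dist x p = dist x q}"
proof
  \<comment> \<open>\<open>c *\<^sub>R n\<close> is the foot of the perpendicular from the origin to the plane\<close>
  define c where "c = k / (n \<bullet> n)"
  let ?p = "c *\<^sub>R n - n" and ?q = "c *\<^sub>R n + n"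
  have diff: "?q - ?p = 2 *\<^sub>R n" by (simp add: scaleR_2)
  moreover have "2 *\<^sub>R n \<noteq> 0" using assms by simp
  ultimately show "?p \<noteq> ?q" by (metis right_minus_eq)
  have "(?q \<bullet> ?q - ?p \<bullet> ?p) / 2 = 2 * (c * (n \<bullet> n))"
    by (simp add: inner_diff_left inner_diff_right inner_add_left inner_add_right algebra_simps)
  also have "\<dots> = 2 * k" using assms by (simp add: c_def)
  finally show "{x. n \<bullet> x = k} = {x. dist x ?p = dist x ?q}"
    unfolding equidistant_eq_plane diff by simp
qed

lemma is_sphere_similarity:
  fixes \<sigma> :: "complex \<times> real \<Rightarrow> complex \<times> real"
  assumes "surj \<sigma>" "0 < l" and dist: "\<And>x y. dist (\<sigma> x) (\<sigma> y) = l * dist x y"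
    and "is_sphere \<Sigma>"
  shows "is_sphere (map_option \<sigma> ` \<Sigma>)"
  using \<open>is_sphere \<Sigma>\<close> unfolding is_sphere_def
proof (elim disjE exE conjE)
  fix p r assume r: "0 < r" and S: "\<Sigma> = Some ` sphere p r"
  have "\<sigma> ` sphere p r = sphere (\<sigma> p) (l * r)"
  proof (intro set_eqI iffI)
    fix y assume "y \<in> sphere (\<sigma> p) (l * r)"
    moreover obtain x where "y = \<sigma> x" using \<open>surj \<sigma>\<close> by blast
    ultimately show "y \<in> \<sigma> ` sphere p r" using dist \<open>0 < l\<close> by auto
  qed (auto simp: dist)
  then have "map_option \<sigma> ` \<Sigma> = Some ` sphere (\<sigma> p) (l * r)"
    using S by (metis (no_types, lifting) image_cong image_image option.map(2))
  moreover have "0 < l * r" using r \<open>0 < l\<close> by simp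
  ultimately show "(\<exists>p r. 0 < r \<and> map_option \<sigma> ` \<Sigma> = Some ` sphere p r) \<or>
      (\<exists>n k. n \<noteq> 0 \<and> map_option \<sigma> ` \<Sigma> = insert None (Some ` {x. n \<bullet> x = k}))"
    by blast
next
  fix n k assume "n \<noteq> 0" and S: "\<Sigma> = insert None (Some ` {x. n \<bullet> x = k})"
  then obtain p q where pq: "p \<noteq> q" "{x. n \<bullet> x = k} = {x. dist x p = dist x q}"
    by (metis plane_eq_equidistant)
  have "\<sigma> ` {x. dist x p = dist x q} = {y. dist y (\<sigma> p) = dist y (\<sigma> q)}"
  proof (intro set_eqI iffI)
    fix y assume "y \<in> {y. dist y (\<sigma> p) = dist y (\<sigma> q)}"
    moreover obtain x where "y = \<sigma> x" using \<open>surj \<sigma>\<close> by blast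
    ultimately show "y \<in> \<sigma> ` {x. dist x p = dist x q}" using dist \<open>0 < l\<close> by auto
  qed (auto simp: dist)
  also have "\<dots> = {y. (\<sigma> q - \<sigma> p) \<bullet> y = (\<sigma> q \<bullet> \<sigma> q - \<sigma> p \<bullet> \<sigma> p) / 2}"
    by (rule equidistant_eq_plane)
  finally have "map_option \<sigma> ` \<Sigma> =
      insert None (Some ` {y. (\<sigma> q - \<sigma> p) \<bullet> y = (\<sigma> q \<bullet> \<sigma> q - \<sigma> p \<bullet> \<sigma> p) / 2})"
    unfolding S pq by (auto simp: image_image)
  moreover have "\<sigma> q - \<sigma> p \<noteq> 0" using dist[of q p] pq \<open>0 < l\<close> by auto
  ultimately show "(\<exists>p r. 0 < r \<and> map_option \<sigma> ` \<Sigma> = Some ` sphere p r) \<or>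
      (\<exists>n k. n \<noteq> 0 \<and> map_option \<sigma> ` \<Sigma> = insert None (Some ` {x. n \<bullet> x = k}))"
    by blast
qed

lemma similarity_continuous:
  fixes \<sigma> :: "complex \<times> real \<Rightarrow> complex \<times> real"
  assumes "0 < l" and dist: "\<And>x y. dist (\<sigma> x) (\<sigma> y) = l * dist x y"
    and U: "openin ext_space U"
  shows "openin ext_space {p. map_option \<sigma> p \<in> U}"
proof -
  have V: "open {x. Some x \<in> U}" "None \<in> U \<Longrightarrow> \<forall>\<^sub>F x in at_infinity. Some x \<in> U"
    using U by (auto simp: openin_ext_space_iff)
  have "l-lipschitz_on UNIV \<sigma>"
    using \<open>0 < l\<close> dist by (auto intro: lipschitz_onI)
  then have "continuous_on UNIV \<sigma>" by (rule lipschitz_on_continuous_on)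
  with V(1) have "open (\<sigma> -` {x. Some x \<in> U})" by (rule open_vimage)
  moreover have "\<forall>\<^sub>F x in at_infinity. Some (\<sigma> x) \<in> U" if N: "None \<in> U"
  proof -
    obtain K where K: "\<And>x. K \<le> norm x \<Longrightarrow> Some x \<in> U"
      using V(2)[OF N] by (auto simp: eventually_at_infinity)
    have "Some (\<sigma> x) \<in> U" if "(K + norm (\<sigma> 0)) / l \<le> norm x" for x
    proof (rule K)
      have "l * norm x = norm (\<sigma> x - \<sigma> 0)" using dist[of x 0] by (simp add: dist_norm)
      also have "\<dots> \<le> norm (\<sigma> x) + norm (\<sigma> 0)" by (rule norm_triangle_ineq4)
      finally show "K \<le> norm (\<sigma> x)" using that \<open>0 < l\<close> by (simp add: field_simps)
    qed
    then show ?thesis by (auto simp: eventually_at_infinity)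
  qed
  ultimately show ?thesis by (auto simp: openin_ext_space_iff vimage_def)
qed

lemma is_poincare_extension_similarity_ext:
  assumes "a \<noteq> 0" "d \<noteq> 0"
  shows "is_poincare_extension (moebius a b 0 d) (similarity_ext a b d)"
  unfolding is_poincare_extension_def
proof (intro conjI allI impI)
  define \<sigma> where "\<sigma> = (\<lambda>x. ((a * fst x + b) / d, cmod (a / d) * snd x))"
  define l where "l = cmod (a / d)"
  have G: "similarity_ext a b d = map_option \<sigma>" by (simp add: similarity_ext_def \<sigma>_def)
  have l: "0 < l" using assms by (simp add: l_def)
  have dist: "dist (\<sigma> x) (\<sigma> y) = l * dist x y" for x y
  proof -
    have "fst (\<sigma> x) - fst (\<sigma> y) = (a / d) * (fst x - fst y)"
      using assms by (simp add: \<sigma>_def field_simps)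
    then have 1: "dist (fst (\<sigma> x)) (fst (\<sigma> y)) = l * dist (fst x) (fst y)"
      by (simp add: dist_norm l_def norm_mult norm_divide)
    have "snd (\<sigma> x) - snd (\<sigma> y) = l * (snd x - snd y)"
      by (simp add: \<sigma>_def l_def algebra_simps)
    then have 2: "dist (snd (\<sigma> x)) (snd (\<sigma> y)) = l * dist (snd x) (snd y)"
      using l by (simp add: dist_norm abs_mult)
    show ?thesis unfolding dist_prod_def[of "\<sigma> x"] 1 2 power_mult_distrib
      using l by (simp add: dist_prod_def real_sqrt_mult flip: distrib_left)
  qed
  have "\<exists>x. \<sigma> x = y" for y
  proof -
    have "map_option \<sigma> (similarity_ext d (- b) a (Some y)) = Some y"
      using similarity_ext_inverse[of d a "- b" "Some y"] assms by (simp add: G)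
    then show ?thesis by (auto simp only: map_option_eq_Some)
  qed
  then have surj: "surj \<sigma>" by (metis surj_def)
  have "similarity_ext a b d p \<in> upper_half_space" if "p \<in> upper_half_space" for p
    using that by (auto simp: similarity_ext_def upper_half_space_def)
  then show "continuous_map (subtopology ext_space upper_half_space)
           (subtopology ext_space upper_half_space) (similarity_ext a b d)"
    using similarity_continuous[OF l dist] unfolding G by (intro continuous_map_ext_spaceI) auto
  show "is_sphere (similarity_ext a b d ` \<Sigma>)" if "is_sphere \<Sigma> \<and> \<Sigma> \<subseteq> upper_half_space" for \<Sigma>
    unfolding G using is_sphere_similarity[OF surj l dist] that by blast
  show "similarity_ext a b d (boundary_point w) = boundary_point (moebius a b 0 d w)" for w
    using assms by (auto simp: similarity_ext_def boundary_point_def moebius_def split: option.split)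
qed

section \<open>Composition of extensions\<close>

lemma is_poincare_extension_comp:
  assumes F: "is_poincare_extension m F" and F': "is_poincare_extension m' F'"
  shows "is_poincare_extension (m \<circ> m') (F \<circ> F')"
  unfolding is_poincare_extension_def
proof (intro conjI allI impI)
  show "continuous_map (subtopology ext_space upper_half_space)
           (subtopology ext_space upper_half_space) (F \<circ> F')"
    using F F' by (auto simp: is_poincare_extension_def intro: continuous_map_compose)
  show "(F \<circ> F') (boundary_point w) = boundary_point ((m \<circ> m') w)" for w
    using F F' by (simp add: is_poincare_extension_def)
  fix \<Sigma> assume S: "is_sphere \<Sigma> \<and> \<Sigma> \<subseteq> upper_half_space"
  have "F' ` upper_half_space \<subseteq> upper_half_space"
    using F' by (auto simp: is_poincare_extension_def continuous_map_def)
  then have "F' ` \<Sigma> \<subseteq> upper_half_space" using S by blast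
  moreover have "is_sphere (F' ` \<Sigma>)" using F' S by (auto simp: is_poincare_extension_def)
  ultimately have "is_sphere (F ` F' ` \<Sigma>)"
    using F by (auto simp: is_poincare_extension_def)
  then show "is_sphere ((F \<circ> F') ` \<Sigma>)" by (simp only: image_comp)
qed

lemma is_poincare_extension_cong:
  assumes F: "is_poincare_extension m F" and eq: "\<And>p. p \<in> upper_half_space \<Longrightarrow> F p = G p"
  shows "is_poincare_extension m G"
  unfolding is_poincare_extension_def
proof (intro conjI allI impI)
  show "continuous_map (subtopology ext_space upper_half_space)
           (subtopology ext_space upper_half_space) G"
    using F eq by (auto simp: is_poincare_extension_def intro: continuous_map_eq)
  have "boundary_point w \<in> upper_half_space" for w
    by (cases w) (auto simp: boundary_point_def)
  then show "G (boundary_point w) = boundary_point (m w)" for w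
    using F eq by (auto simp: is_poincare_extension_def)
  fix \<Sigma> assume S: "is_sphere \<Sigma> \<and> \<Sigma> \<subseteq> upper_half_space"
  then have "F ` \<Sigma> = G ` \<Sigma>" using eq by (intro image_cong) auto
  then show "is_sphere (G ` \<Sigma>)" using F S by (metis is_poincare_extension_def)
qed

section \<open>The action of the generators on the spheres S\<close>

text \<open>
  One equation covers the tangent spheres, the horizontal planes and the boundary plane; it is
  the form in which the action of the generators is a computation.
\<close>

lemma S_sphere_mem:
  "Some x \<in> S_sphere \<alpha> \<beta> \<longleftrightarrow> (cmod (\<beta> * fst x - \<alpha>))\<^sup>2 + (cmod \<beta>)\<^sup>2 * (snd x)\<^sup>2 = snd x"
  "None \<in> S_sphere \<alpha> \<beta> \<longleftrightarrow> \<beta> = 0"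
proof -
  show "None \<in> S_sphere \<alpha> \<beta> \<longleftrightarrow> \<beta> = 0" by (auto simp: S_sphere_def normal_sphere_def)
  show "Some x \<in> S_sphere \<alpha> \<beta> \<longleftrightarrow> (cmod (\<beta> * fst x - \<alpha>))\<^sup>2 + (cmod \<beta>)\<^sup>2 * (snd x)\<^sup>2 = snd x"
  proof (cases "\<beta> = 0")
    case True then show ?thesis by (auto simp: S_sphere_def)
  next
    case False
    define B where "B = (cmod \<beta>)\<^sup>2"
    have B: "0 < B" using False by (simp add: B_def)
    define D where "D = (cmod (fst x - \<alpha> / \<beta>))\<^sup>2"
    define r where "r = 1 / (2 * B)"
    have r: "0 < r" using B by (simp add: r_def)
    have "\<beta> * fst x - \<alpha> = \<beta> * (fst x - \<alpha> / \<beta>)" using False by (simp add: field_simps)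
    then have 1: "(cmod (\<beta> * fst x - \<alpha>))\<^sup>2 = B * D"
      by (simp only: norm_mult power_mult_distrib B_def D_def)
    have "Some x \<in> S_sphere \<alpha> \<beta> \<longleftrightarrow> dist x (\<alpha> / \<beta>, r) = r"
      using False by (auto simp: S_sphere_def normal_sphere_def B_def r_def dist_commute)
    also have "\<dots> \<longleftrightarrow> (dist x (\<alpha> / \<beta>, r))\<^sup>2 = r\<^sup>2"
      using r by simp
    also have "(dist x (\<alpha> / \<beta>, r))\<^sup>2 = D + (snd x - r)\<^sup>2"
      by (simp add: dist_prod_def D_def dist_norm)
    also have "\<dots> = r\<^sup>2 \<longleftrightarrow> D + (snd x)\<^sup>2 = 2 * r * snd x"
      by (auto simp: power2_eq_square algebra_simps)
    also have "\<dots> \<longleftrightarrow> B * D + B * (snd x)\<^sup>2 = snd x"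
      using B by (auto simp: r_def field_simps)
    finally show ?thesis by (simp add: 1 B_def)
  qed
qed

lemma S_sphere_subset: "S_sphere \<alpha> \<beta> \<subseteq> upper_half_space"
proof
  fix p assume p: "p \<in> S_sphere \<alpha> \<beta>"
  show "p \<in> upper_half_space"
  proof (cases p)
    case (Some x)
    then have "0 \<le> snd x" using p by (metis S_sphere_mem(1) add_nonneg_nonneg mult_nonneg_nonneg zero_le_power2)
    then show ?thesis using Some by (auto simp: upper_half_space_def)
  qed simp
qed

text \<open>
  Substituting the image point multiplies the equation of the sphere by \<open>\<bar>a / d\<bar>\<close>: the factor
  \<open>D\<close> with \<open>\<bar>D\<bar>\<^sup>2 = \<bar>a d\<bar>\<close> is the one that makes both of its sides scale alike.
\<close>

lemma similarity_ext_S_sphere: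
  assumes "a \<noteq> 0" "d \<noteq> 0" and D: "D = complex_of_real (sqrt (cmod (a * d)))"
  shows "similarity_ext a b d ` S_sphere \<alpha> \<beta> = S_sphere ((a * \<alpha> + b * \<beta>) / D) (d * \<beta> / D)"
proof (rule image_eq_of_mem_iff)
  show "similarity_ext a b d (similarity_ext d (- b) a q) = q" for q
    using similarity_ext_inverse[of d a "- b"] assms by simp
  fix p
  have D2: "(cmod D)\<^sup>2 = cmod a * cmod d" "D \<noteq> 0" using assms by (simp_all add: norm_mult)
  show "similarity_ext a b d p \<in> S_sphere ((a * \<alpha> + b * \<beta>) / D) (d * \<beta> / D) \<longleftrightarrow> p \<in> S_sphere \<alpha> \<beta>"
  proof (cases p)
    case None then show ?thesis
      using assms D2 by (simp add: similarity_ext_def S_sphere_mem del: of_real_eq_0_iff)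
  next
    case (Some x)
    define l where "l = cmod a / cmod d"
    have l: "l > 0" using assms by (simp add: l_def)
    have "d * \<beta> / D * ((a * fst x + b) / d) - (a * \<alpha> + b * \<beta>) / D = a / D * (\<beta> * fst x - \<alpha>)"
      using assms D2 by (simp add: field_simps)
    then have "(cmod (d * \<beta> / D * ((a * fst x + b) / d) - (a * \<alpha> + b * \<beta>) / D))\<^sup>2
        = (cmod a)\<^sup>2 / (cmod D)\<^sup>2 * (cmod (\<beta> * fst x - \<alpha>))\<^sup>2"
      by (simp add: norm_mult norm_divide power_mult_distrib power_divide)
    also have "(cmod a)\<^sup>2 / (cmod D)\<^sup>2 = l"
      unfolding D2 using assms by (simp add: l_def power2_eq_square)
    finally have 1: "(cmod (d * \<beta> / D * ((a * fst x + b) / d) - (a * \<alpha> + b * \<beta>) / D))\<^sup>2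
        = l * (cmod (\<beta> * fst x - \<alpha>))\<^sup>2" .
    have "(cmod (d * \<beta> / D))\<^sup>2 = (cmod d)\<^sup>2 * (cmod \<beta>)\<^sup>2 / (cmod D)\<^sup>2"
      by (simp add: norm_mult norm_divide power_mult_distrib power_divide)
    also have "\<dots> = (cmod \<beta>)\<^sup>2 / l"
      unfolding D2 using assms by (simp add: l_def power2_eq_square)
    finally have 2: "(cmod (d * \<beta> / D))\<^sup>2 = (cmod \<beta>)\<^sup>2 / l" .
    have "similarity_ext a b d p = Some ((a * fst x + b) / d, l * snd x)"
      using Some by (simp add: similarity_ext_def l_def norm_divide)
    then have "similarity_ext a b d p \<in> S_sphere ((a * \<alpha> + b * \<beta>) / D) (d * \<beta> / D) \<longleftrightarrow>
        l * (cmod (\<beta> * fst x - \<alpha>))\<^sup>2 + (cmod \<beta>)\<^sup>2 / l * (l * snd x)\<^sup>2 = l * snd x"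
      by (simp only: S_sphere_mem fst_conv snd_conv 1 2)
    also have "(cmod \<beta>)\<^sup>2 / l * (l * snd x)\<^sup>2 = l * ((cmod \<beta>)\<^sup>2 * (snd x)\<^sup>2)"
      using l by (simp add: power2_eq_square)
    also have "l * (cmod (\<beta> * fst x - \<alpha>))\<^sup>2 + \<dots> = l * snd x \<longleftrightarrow>
        (cmod (\<beta> * fst x - \<alpha>))\<^sup>2 + (cmod \<beta>)\<^sup>2 * (snd x)\<^sup>2 = snd x"
      using l by (simp flip: distrib_left)
    finally show ?thesis by (simp add: Some S_sphere_mem)
  qed
qed

text \<open>
  With \<open>N = \<bar>z\<bar>\<^sup>2 + t\<^sup>2\<close>, both equations expand to
  \<open>\<bar>\<alpha>\<bar>\<^sup>2 - 2 (\<beta> z \<bullet> \<alpha>) + \<bar>\<beta>\<bar>\<^sup>2 N = t\<close>; the one at the image point is divided by \<open>N\<close>.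
\<close>

lemma inversion_ext_S_sphere: "inversion_ext ` S_sphere \<alpha> \<beta> = S_sphere \<beta> \<alpha>"
proof (rule image_eq_of_mem_iff[where G' = inversion_ext])
  fix p
  show "inversion_ext p \<in> S_sphere \<beta> \<alpha> \<longleftrightarrow> p \<in> S_sphere \<alpha> \<beta>"
  proof (cases p)
    case None then show ?thesis by (simp add: inversion_ext_simps S_sphere_mem)
  next
    case (Some x)
    show ?thesis
    proof (cases "x = 0")
      case True then show ?thesis using Some by (simp add: inversion_ext_simps S_sphere_mem)
    next
      case False
      define z t where "z = fst x" and "t = snd x"
      define N where "N = x \<bullet> x"
      have N: "N > 0" "N = (cmod z)\<^sup>2 + t\<^sup>2"
        using False by (simp_all add: N_def z_def t_def power2_norm_eq_inner) (simp add: inner_prod_def power2_eq_square)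
      have exp: "(cmod (u - v))\<^sup>2 = (cmod u)\<^sup>2 - 2 * (u \<bullet> v) + (cmod v)\<^sup>2" for u v
        by (simp add: power2_norm_eq_inner inner_diff_left inner_diff_right inner_commute)
      have io: "(\<alpha> * (cnj z /\<^sub>R N)) \<bullet> \<beta> = (\<beta> * z) \<bullet> \<alpha> / N"
        by (simp add: inner_complex_def divide_inverse algebra_simps)
      have "inversion_ext p = Some (cnj z /\<^sub>R N, t / N)"
        using Some False by (simp add: inversion_ext_simps hconj_def N_def z_def t_def divide_inverse)
      then have "inversion_ext p \<in> S_sphere \<beta> \<alpha> \<longleftrightarrow>
          (cmod (\<alpha> * (cnj z /\<^sub>R N) - \<beta>))\<^sup>2 + (cmod \<alpha>)\<^sup>2 * (t / N)\<^sup>2 = t / N"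
        by (simp add: S_sphere_mem)
      also have "(cmod (\<alpha> * (cnj z /\<^sub>R N) - \<beta>))\<^sup>2 =
          (cmod \<alpha>)\<^sup>2 * (cmod z)\<^sup>2 / N\<^sup>2 - 2 * ((\<beta> * z) \<bullet> \<alpha>) / N + (cmod \<beta>)\<^sup>2"
        unfolding exp io by (simp add: norm_mult power_mult_distrib power_inverse divide_inverse)
      also have "\<dots> + (cmod \<alpha>)\<^sup>2 * (t / N)\<^sup>2 =
          (cmod \<alpha>)\<^sup>2 * ((cmod z)\<^sup>2 + t\<^sup>2) / N\<^sup>2 - 2 * ((\<beta> * z) \<bullet> \<alpha>) / N + (cmod \<beta>)\<^sup>2"
        by (simp add: power_divide distrib_left add_divide_distrib)
      also have "\<dots> = ((cmod \<alpha>)\<^sup>2 - 2 * ((\<beta> * z) \<bullet> \<alpha>) + (cmod \<beta>)\<^sup>2 * N) / N"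
        unfolding N(2)[symmetric] using N(1) by (simp add: field_simps power2_eq_square)
      also have "(cmod \<alpha>)\<^sup>2 - 2 * ((\<beta> * z) \<bullet> \<alpha>) + (cmod \<beta>)\<^sup>2 * N =
          (cmod (\<beta> * z - \<alpha>))\<^sup>2 + (cmod \<beta>)\<^sup>2 * t\<^sup>2"
        unfolding exp N(2) by (simp add: norm_mult power_mult_distrib algebra_simps)
      also have "\<dots> / N = t / N \<longleftrightarrow> (cmod (\<beta> * z - \<alpha>))\<^sup>2 + (cmod \<beta>)\<^sup>2 * t\<^sup>2 = t"
        using N(1) by simp
      finally show ?thesis by (simp add: Some S_sphere_mem z_def t_def)
    qed
  qed
qed simp

section \<open>Spheres that touch the boundary\<close>

definition horizontal_plane :: "real \<Rightarrow> (complex \<times> real) option set" where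
  "horizontal_plane h = insert None (Some ` {x. snd x = h})"

lemma mem_horizontal_plane [simp]:
  "None \<in> horizontal_plane h"
  "Some x \<in> horizontal_plane h \<longleftrightarrow> snd x = h"
  by (auto simp: horizontal_plane_def)

lemma mem_normal_sphere:
  assumes "0 < r"
  shows "Some (z, t) \<in> normal_sphere w r \<longleftrightarrow> (cmod (z - w))\<^sup>2 + t\<^sup>2 = 2 * r * t"
proof -
  have "Some (z, t) \<in> normal_sphere w r \<longleftrightarrow> dist (z, t) (w, r) = r"
    by (auto simp: normal_sphere_def dist_commute)
  also have "\<dots> \<longleftrightarrow> (dist (z, t) (w, r))\<^sup>2 = r\<^sup>2"
    using assms by simp
  also have "(dist (z, t) (w, r))\<^sup>2 = (cmod (z - w))\<^sup>2 + (t - r)\<^sup>2"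
    by (simp add: dist_prod_def dist_norm)
  also have "\<dots> = r\<^sup>2 \<longleftrightarrow> (cmod (z - w))\<^sup>2 + t\<^sup>2 = 2 * r * t"
    by (auto simp: power2_eq_square algebra_simps)
  finally show ?thesis .
qed

lemma None_notin_normal_sphere [simp]: "None \<notin> normal_sphere w r"
  by (auto simp: normal_sphere_def)

lemma normal_sphere_subset: "0 < r \<Longrightarrow> normal_sphere w r \<subseteq> upper_half_space"
proof
  fix p assume "0 < r" and p: "p \<in> normal_sphere w r"
  then obtain z t where [simp]: "p = Some (z, t)" by (cases p) auto
  have "2 * r * t = (cmod (z - w))\<^sup>2 + t\<^sup>2" using p \<open>0 < r\<close> by (simp add: mem_normal_sphere)
  then have "0 \<le> 2 * r * t" by simp
  then show "p \<in> upper_half_space" using \<open>0 < r\<close> by (simp add: zero_le_mult_iff)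
qed

lemma is_sphere_normal_sphere: "0 < r \<Longrightarrow> is_sphere (normal_sphere w r)"
  unfolding is_sphere_def normal_sphere_def by blast

lemma is_sphere_horizontal_plane: "is_sphere (horizontal_plane h)"
proof -
  have "horizontal_plane h = insert None (Some ` {x. (0, 1) \<bullet> x = h})"
    by (simp add: horizontal_plane_def inner_prod_def)
  moreover have "(0, 1) \<noteq> (0 :: complex \<times> real)" by (simp add: zero_prod_def)
  ultimately show ?thesis unfolding is_sphere_def by metis
qed

text \<open>
  A plane that is not horizontal descends to height \<open>-1\<close>.
\<close>

lemma plane_in_upper_half_space:
  assumes n: "n \<noteq> 0" and S: "insert None (Some ` {x. n \<bullet> x = k}) \<subseteq> upper_half_space"
  obtains h where "0 \<le> h" "insert None (Some ` {x. n \<bullet> x = k}) = horizontal_plane h"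
proof -
  obtain u s where us: "n = (u, s)" by (cases n)
  have inn: "n \<bullet> x = u \<bullet> fst x + s * snd x" for x by (simp add: us inner_prod_def)
  have "u = 0"
  proof (rule ccontr)
    assume "u \<noteq> 0"
    then have "n \<bullet> (((k + s) / (u \<bullet> u)) *\<^sub>R u, - 1) = k" by (simp add: inn)
    then have "Some (((k + s) / (u \<bullet> u)) *\<^sub>R u, - 1) \<in> upper_half_space" using S by blast
    then show False by simp
  qed
  then have "s \<noteq> 0" using n us by (auto simp: zero_prod_def)
  have "n \<bullet> x = k \<longleftrightarrow> snd x = k / s" for x
    using \<open>s \<noteq> 0\<close> \<open>u = 0\<close> by (auto simp: inn field_simps)
  then have eq: "insert None (Some ` {x. n \<bullet> x = k}) = horizontal_plane (k / s)"
    by (simp add: horizontal_plane_def)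
  moreover have "Some (0, k / s) \<in> horizontal_plane (k / s)" by simp
  ultimately have "Some (0, k / s) \<in> upper_half_space" using S by blast
  then show thesis using that[OF _ eq] by simp
qed

lemma sphere_through_infinity:
  assumes S: "is_sphere \<Sigma>" "\<Sigma> \<subseteq> upper_half_space" "None \<in> \<Sigma>"
  obtains h where "0 \<le> h" "\<Sigma> = horizontal_plane h"
proof -
  obtain n k where "n \<noteq> 0" "\<Sigma> = insert None (Some ` {x. n \<bullet> x = k})"
    using S unfolding is_sphere_def by blast
  then show thesis using plane_in_upper_half_space[of n k] S that by metis
qed

text \<open>
  A sphere in the closed half-space through a boundary point must touch the boundary there, since
  its lowest point is not below the boundary.  The boundary plane itself is the degenerate case
  that has to be carried along.
\<close>

lemma sphere_through_boundary_point:
  assumes S: "is_sphere \<Sigma>" "\<Sigma> \<subseteq> upper_half_space" and w: "Some (w, 0) \<in> \<Sigma>"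
  shows "(\<exists>r>0. \<Sigma> = normal_sphere w r) \<or> \<Sigma> = horizontal_plane 0"
  using S(1) unfolding is_sphere_def
proof (elim disjE exE conjE)
  fix p r assume r: "0 < r" and Sp: "\<Sigma> = Some ` sphere p r"
  obtain u s where p: "p = (u, s)" by (cases p)
  have "(u, s - r) \<in> sphere p r" using r by (simp add: p dist_prod_def)
  then have "Some (u, s - r) \<in> upper_half_space" using S(2) Sp by blast
  then have sr: "r \<le> s" by simp
  have "dist (u, s) (w, 0) = r" using w Sp p by auto
  then have "(dist u w)\<^sup>2 + s\<^sup>2 = r\<^sup>2" by (auto simp: dist_prod_def)
  moreover have "r\<^sup>2 \<le> s\<^sup>2" using sr r by simp
  ultimately have "(dist u w)\<^sup>2 = 0" "s\<^sup>2 = r\<^sup>2" using zero_le_power2[of "dist u w"] by linarith+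
  then have "u = w" "s = r" using sr r by (simp_all)
  then have "\<Sigma> = normal_sphere w r" using Sp p by (simp add: normal_sphere_def)
  then show ?thesis using r by blast
next
  fix n k assume n: "n \<noteq> 0" and Sp: "\<Sigma> = insert None (Some ` {x. n \<bullet> x = k})"
  then obtain h where "\<Sigma> = horizontal_plane h" using plane_in_upper_half_space S(2) by metis
  moreover from this have "h = 0" using w by simp
  ultimately show ?thesis by blast
qed

section \<open>Two rigidity lemmas\<close>

text \<open>
  Choose a preimage \<open>z\<close> of \<open>w\<close> and put \<open>u = z - w\<close>.  The circle about \<open>w\<close> through \<open>z\<close> collapses to
  \<open>w\<close>, so it contains two antipodal points \<open>w + u\<close> and \<open>w - u\<close> that are mapped to \<open>w\<close>.  The point
  \<open>w\<close> is as far from the midpoint \<open>w + u / 2\<close> as \<open>w + u\<close> is; hence so are their images, which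
  gives \<open>\<bar>f w - (w + u / 2)\<bar> = \<bar>u\<bar> / 2\<close>, and likewise for \<open>- u\<close>.  Two circles that touch at \<open>w\<close>
  have no other common point.
\<close>

lemma concentric_circle_map_is_id:
  fixes f :: "'a::real_inner \<Rightarrow> 'a"
  assumes "surj f"
    and circ: "\<And>w x y. dist x w = dist y w \<Longrightarrow> dist (f x) w = dist (f y) w"
  shows "f w = w"
proof -
  obtain z where z: "f z = w" using \<open>surj f\<close> by (metis surjD)
  define u where "u = z - w"
  have fixed: "f (w + u) = w" "f (w - u) = w"
    using circ[of "w - u" w z] z by (simp_all add: u_def dist_norm norm_minus_commute)
  have *: "dist (f w) (w + v) = norm v" if "f (w + 2 *\<^sub>R v) = w" for v
    using circ[of w "w + v" "w + 2 *\<^sub>R v"] that by (simp add: dist_norm scaleR_2)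
  define x where "x = f w - w"
  have "norm (x - (1/2) *\<^sub>R u) = norm ((1/2) *\<^sub>R u)" "norm (x + (1/2) *\<^sub>R u) = norm ((1/2) *\<^sub>R u)"
    using *[of "(1/2) *\<^sub>R u"] *[of "- (1/2) *\<^sub>R u"] fixed
    by (simp_all add: x_def dist_norm algebra_simps)
  then have "(x - (1/2) *\<^sub>R u) \<bullet> (x - (1/2) *\<^sub>R u) = ((1/2) *\<^sub>R u) \<bullet> ((1/2) *\<^sub>R u)"
    "(x + (1/2) *\<^sub>R u) \<bullet> (x + (1/2) *\<^sub>R u) = ((1/2) *\<^sub>R u) \<bullet> ((1/2) *\<^sub>R u)"
    by (simp_all only: norm_eq)
  then have "x \<bullet> x = 0"
    by (simp add: inner_diff_left inner_diff_right inner_add_left inner_add_right inner_commute)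
  then show ?thesis by (simp add: x_def)
qed

text \<open>
  At \<open>s = t / 2\<close> the right side is \<open>t\<^sup>2 / 4\<close>, while the left side is at most \<open>(\<psi> t)\<^sup>2 / 4\<close>; hence
  \<open>\<psi> t \<ge> t\<close>.  With \<open>\<psi> s \<ge> s\<close> the equation gives \<open>\<psi> t - \<psi> s \<le> t - s\<close>, so the excess
  \<open>\<psi> t - t\<close> is antitone; being nonnegative and arbitrarily small near \<open>0\<close>, it vanishes.
\<close>

lemma height_function_is_id:
  fixes \<psi> :: "real \<Rightarrow> real"
  assumes pos: "\<And>t. 0 < t \<Longrightarrow> 0 < \<psi> t"
    and eq: "\<And>s t. 0 < s \<Longrightarrow> s \<le> t \<Longrightarrow> \<psi> s * (\<psi> t - \<psi> s) = s * (t - s)"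
    and small: "\<And>e. 0 < e \<Longrightarrow> \<exists>d>0. \<forall>t. 0 < t \<and> t < d \<longrightarrow> \<psi> t < e"
    and "0 < t"
  shows "\<psi> t = t"
proof -
  have ge: "t \<le> \<psi> t" if "0 < t" for t
  proof -
    have "(\<psi> t)\<^sup>2 - t\<^sup>2 = (\<psi> t - 2 * \<psi> (t / 2))\<^sup>2"
      using eq[of "t / 2" t] that by (simp add: power2_eq_square algebra_simps)
    then have "t\<^sup>2 \<le> (\<psi> t)\<^sup>2" using zero_le_power2[of "\<psi> t - 2 * \<psi> (t / 2)"] by linarith
    then show ?thesis using pos[OF that] by (simp add: power2_le_iff_abs_le)
  qed
  have step: "\<psi> t - \<psi> s \<le> t - s" if "0 < s" "s \<le> t" for s
  proof -
    have "\<psi> s * (\<psi> t - \<psi> s) \<le> \<psi> s * (t - s)"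
      using eq[OF that] ge[OF that(1)] that by (simp add: mult_right_mono)
    then show ?thesis using pos[OF that(1)] by simp
  qed
  have "\<psi> t \<le> t"
  proof (rule field_le_epsilon)
    fix e :: real assume "0 < e"
    then obtain d where "0 < d" and d: "\<And>s. 0 < s \<Longrightarrow> s < d \<Longrightarrow> \<psi> s < e"
      using small by blast
    define s where "s = min t (d / 2)"
    have "0 < s" "s \<le> t" "s < d" using \<open>0 < t\<close> \<open>0 < d\<close> by (auto simp: s_def)
    then show "\<psi> t \<le> t + e" using step[of s] d[of s] by linarith
  qed
  then show ?thesis using ge[OF \<open>0 < t\<close>] by simp
qed

section \<open>Uniqueness of the extension of the identity\<close>

text \<open>
  Injectivity is not among the properties of an extension.  It has to be excluded in particular
  that interior points are mapped into the boundary plane.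
\<close>

locale extension_of_identity =
  fixes F :: "(complex \<times> real) option \<Rightarrow> (complex \<times> real) option"
  assumes ext: "is_poincare_extension (\<lambda>w. w) F"
begin

lemma maps_to: "p \<in> upper_half_space \<Longrightarrow> F p \<in> upper_half_space"
  using ext by (auto simp: is_poincare_extension_def continuous_map_def)

lemma boundary [simp]: "F None = None" "F (Some (z, 0)) = Some (z, 0)"
proof -
  have "F (boundary_point w) = boundary_point w" for w
    using ext by (auto simp: is_poincare_extension_def)
  from this[of None] this[of "Some z"] show "F None = None" "F (Some (z, 0)) = Some (z, 0)"
    by (simp_all add: boundary_point_def)
qed

lemma image_sphere:
  assumes "is_sphere \<Sigma>" "\<Sigma> \<subseteq> upper_half_space"
  shows "is_sphere (F ` \<Sigma>)" "F ` \<Sigma> \<subseteq> upper_half_space"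
  using ext assms maps_to by (auto simp: is_poincare_extension_def)

lemma image_normal_sphere:
  assumes "0 < r"
  shows "(\<exists>r'>0. F ` normal_sphere w r = normal_sphere w r') \<or> F ` normal_sphere w r = horizontal_plane 0"
proof (rule sphere_through_boundary_point)
  have "Some (w, 0) \<in> normal_sphere w r" using assms by (simp add: mem_normal_sphere)
  then show "Some (w, 0) \<in> F ` normal_sphere w r" using boundary(2)[of w] by (metis imageI)
qed (use image_sphere is_sphere_normal_sphere normal_sphere_subset assms in auto)

lemma image_horizontal_plane:
  assumes "0 \<le> h"
  obtains h' where "0 \<le> h'" "F ` horizontal_plane h = horizontal_plane h'"
proof (rule sphere_through_infinity)
  have "horizontal_plane h \<subseteq> upper_half_space" using assms by (auto simp: horizontal_plane_def)
  then show "is_sphere (F ` horizontal_plane h)" "F ` horizontal_plane h \<subseteq> upper_half_space"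
    using image_sphere is_sphere_horizontal_plane by metis+
  show "None \<in> F ` horizontal_plane h" using boundary(1) mem_horizontal_plane(1) by (metis imageI)
qed (use that in blast)

lemma preimage_open:
  assumes "openin ext_space U"
  obtains V where "openin ext_space V" "\<And>p. p \<in> upper_half_space \<Longrightarrow> F p \<in> U \<longleftrightarrow> p \<in> V"
proof -
  let ?H = "subtopology ext_space upper_half_space"
  have "continuous_map ?H ?H F" using ext by (simp add: is_poincare_extension_def)
  then have "continuous_map ?H ext_space F" by (simp add: continuous_map_in_subtopology)
  then have "openin ?H {p \<in> topspace ?H. F p \<in> U}" using assms by (simp add: continuous_map_def)
  then obtain V where "openin ext_space V" "{p \<in> upper_half_space. F p \<in> U} = V \<inter> upper_half_space"
    by (auto simp: openin_subtopology)
  then show thesis using that by blast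
qed

text \<open>
  A high plane lies near infinity, and so does its image.  The boundary plane does not, as it
  passes through the origin.
\<close>

lemma some_plane_stays_interior:
  obtains T h where "0 < T" "0 < h" "F ` horizontal_plane T = horizontal_plane h"
proof -
  have far: "openin ext_space (insert None (Some ` {x. 1 < norm x}))"
    by (auto simp: openin_ext_space_iff eventually_at_infinity image_iff
        intro!: open_Collect_less continuous_intros exI[of _ 2])
  obtain V where V: "openin ext_space V"
    "\<And>p. p \<in> upper_half_space \<Longrightarrow> F p \<in> insert None (Some ` {x. 1 < norm x}) \<longleftrightarrow> p \<in> V"
    using preimage_open[OF far] by blast
  then have "None \<in> V" by (metis boundary(1) insertI1 mem_upper_half_space(1))
  then obtain K where K: "\<And>x. K \<le> norm x \<Longrightarrow> Some x \<in> V"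
    using V(1) by (auto simp: openin_ext_space_iff eventually_at_infinity)
  \<comment> \<open>a point of height \<open>T\<close> has norm at least \<open>K\<close>\<close>
  define T where "T = max K 1"
  have "0 < T" by (simp add: T_def)
  obtain h where h: "0 \<le> h" "F ` horizontal_plane T = horizontal_plane h"
    using image_horizontal_plane[of T] \<open>0 < T\<close> by auto
  have "h \<noteq> 0"
  proof
    assume "h = 0"
    then have "Some 0 \<in> F ` horizontal_plane T" by (simp add: h(2))
    then obtain p where p: "p \<in> horizontal_plane T" "F p = Some 0" by (metis imageE)
    then obtain z where z: "p = Some (z, T)" by (cases p) auto
    have "T \<le> norm (z, T)" using \<open>0 < T\<close> norm_snd_le[of T z] by simp
    then have "p \<in> V" using K[of "(z, T)"] z by (simp add: T_def)
    then have "F p \<in> insert None (Some ` {x. 1 < norm x})"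
      using V(2)[of p] z \<open>0 < T\<close> by simp
    then show False using p by auto
  qed
  then show thesis using that[OF \<open>0 < T\<close> _ h(2)] h(1) by simp
qed

lemma small_near_origin:
  assumes "0 < e"
  shows "\<exists>d>0. \<forall>t. 0 < t \<and> t < d \<longrightarrow> F (Some (0, t)) \<in> Some ` ball 0 e"
proof -
  have near: "openin ext_space (Some ` ball 0 e)"
    by (simp add: ext_space_def)
  obtain V where V: "openin ext_space V"
    "\<And>p. p \<in> upper_half_space \<Longrightarrow> F p \<in> Some ` ball 0 e \<longleftrightarrow> p \<in> V"
    using preimage_open[OF near] by blast
  have "Some (0, 0) \<in> V"
    using V(2)[of "Some (0, 0)"] assms by (simp add: image_iff zero_prod_def)
  then obtain d where d: "0 < d" "\<And>x. dist x (0, 0) < d \<Longrightarrow> Some x \<in> V"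
    using V(1) unfolding openin_ext_space_iff open_dist by blast
  have "F (Some (0, t)) \<in> Some ` ball 0 e" if "0 < t" "t < d" for t
    using d(2)[of "(0, t)"] V(2)[of "Some (0, t)"] that by (simp add: dist_prod_def)
  then show ?thesis using d(1) by blast
qed

text \<open>
  A genuine normal sphere based at \<open>w\<close> meets the boundary plane in \<open>w\<close> only.
\<close>

lemma collapsed_normal_sphere:
  assumes r: "0 < r" and p: "p \<in> normal_sphere w r"
    and c: "F p \<in> horizontal_plane 0" "F p \<noteq> Some (w, 0)"
  shows "F ` normal_sphere w r = horizontal_plane 0"
proof (rule ccontr)
  assume "F ` normal_sphere w r \<noteq> horizontal_plane 0"
  then obtain r' where "0 < r'" "F ` normal_sphere w r = normal_sphere w r'"
    using image_normal_sphere[OF r] by blast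
  then have "F p \<in> normal_sphere w r'" using p by blast
  then show False using c \<open>0 < r'\<close> by (cases "F p") (auto simp: mem_normal_sphere)
qed

text \<open>
  The points \<open>(z, s)\<close> and \<open>(z, t)\<close> lie on a common normal sphere based at \<open>w\<close> whenever
  \<open>\<bar>w - z\<bar>\<^sup>2 = s t\<close>.  At most one such \<open>w\<close> can be the image of \<open>(z, s)\<close>, and any other one carries
  the collapse over to \<open>(z, t)\<close>.
\<close>

lemma collapse_spreads_vertically:
  assumes "0 < s" "0 < t" and c: "F (Some (z, s)) \<in> horizontal_plane 0"
  shows "F (Some (z, t)) \<in> horizontal_plane 0"
proof -
  define \<rho> where "\<rho> = complex_of_real (sqrt (s * t))"
  have \<rho>: "(cmod \<rho>)\<^sup>2 = s * t" "\<rho> \<noteq> 0" using assms by (simp_all add: \<rho>_def)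
  define r where "r = (s + t) / 2"
  have r: "0 < r" using assms by (simp add: r_def)
  have on: "Some (z, s) \<in> normal_sphere w r" "Some (z, t) \<in> normal_sphere w r"
    if "w = z + \<rho> \<or> w = z - \<rho>" for w
    unfolding mem_normal_sphere[OF r] using that \<rho> by (auto simp: r_def power2_eq_square algebra_simps)
  have "z + \<rho> \<noteq> z - \<rho>" using \<rho>(2) by (simp add: eq_neg_iff_add_eq_0)
  then obtain w where w: "w = z + \<rho> \<or> w = z - \<rho>" "F (Some (z, s)) \<noteq> Some (w, 0)"
    by (metis option.inject prod.inject)
  show ?thesis
    using collapsed_normal_sphere[OF r on(1) c w(2)] on(2) w(1) by blast
qed

text \<open>
  If \<open>(z, t)\<close> were mapped into the boundary plane, then so would be the normal sphere through it
  based at \<open>x\<close>, for any \<open>x\<close> that is not the image of \<open>(z, t)\<close>, and with its top the whole vertical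
  line over \<open>x\<close>.  But some plane stays in the interior, and it can be met by such a line at a
  point whose image is finite.
\<close>

lemma interior_to_interior:
  assumes "0 < t"
  obtains z' t' where "0 < t'" "F (Some (z, t)) = Some (z', t')"
proof -
  have "F (Some (z, t)) \<notin> horizontal_plane 0"
  proof
    assume c: "F (Some (z, t)) \<in> horizontal_plane 0"
    obtain T h where T: "0 < T" "0 < h" "F ` horizontal_plane T = horizontal_plane h"
      by (rule some_plane_stays_interior)
    have onto: "\<exists>x. F (Some (x, T)) = Some (y, h)" for y
    proof -
      have "Some (y, h) \<in> F ` horizontal_plane T" by (simp add: T(3))
      then obtain q where "q \<in> horizontal_plane T" "F q = Some (y, h)" by (metis imageE)
      then show ?thesis by (cases q) auto
    qed
    \<comment> \<open>two candidates for the line, since one of them may stand over the image of \<open>(z, t)\<close>\<close>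
    obtain x0 x1 where x: "F (Some (x0, T)) = Some (0, h)" "F (Some (x1, T)) = Some (1, h)"
      using onto by blast
    then have "x0 \<noteq> x1" by auto
    then obtain x y where xy: "F (Some (x, T)) = Some (y, h)" "F (Some (z, t)) \<noteq> Some (x, 0)"
      using x by (cases "F (Some (z, t)) = Some (x0, 0)") auto
    \<comment> \<open>the radius for which the normal sphere based at \<open>x\<close> passes through \<open>(z, t)\<close>\<close>
    define r where "r = ((cmod (z - x))\<^sup>2 + t\<^sup>2) / (2 * t)"
    have r: "0 < r" using assms by (simp add: r_def add_nonneg_pos)
    have "Some (z, t) \<in> normal_sphere x r"
      unfolding mem_normal_sphere[OF r] using assms by (simp add: r_def)
    then have "F ` normal_sphere x r = horizontal_plane 0"
      using collapsed_normal_sphere[OF r _ c xy(2)] by blast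
    moreover have "Some (x, 2 * r) \<in> normal_sphere x r"
      by (simp add: mem_normal_sphere[OF r] power2_eq_square)
    ultimately have "F (Some (x, 2 * r)) \<in> horizontal_plane 0" by blast
    then have "F (Some (x, T)) \<in> horizontal_plane 0"
      using collapse_spreads_vertically[of "2 * r" T] r T by simp
    then show False using xy(1) T by auto
  qed
  moreover have "F (Some (z, t)) \<in> upper_half_space" using maps_to assms by simp
  ultimately show thesis
    using that by (cases "F (Some (z, t))") (auto simp: le_less)
qed

lemma image_normal_sphere_interior:
  assumes r: "0 < r"
  obtains r' where "0 < r'" "F ` normal_sphere w r = normal_sphere w r'"
proof -
  have top: "Some (w, 2 * r) \<in> normal_sphere w r"
    by (simp add: mem_normal_sphere[OF r] power2_eq_square)
  obtain z' t' where "0 < t'" "F (Some (w, 2 * r)) = Some (z', t')"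
    by (rule interior_to_interior[of "2 * r" w]) (use r in auto)
  then have "F ` normal_sphere w r \<noteq> horizontal_plane 0"
    using top by (metis imageI mem_horizontal_plane(2) less_irrefl snd_conv)
  then show thesis using image_normal_sphere[OF r] that by blast
qed

text \<open>
  In a plane of height \<open>t\<close>, the normal spheres based at \<open>w\<close> cut out the circles with centre over
  \<open>w\<close>.  So the induced map of horizontal coordinates sends each circle into a concentric one.  It
  is onto because the image of the plane is a full plane.
\<close>

lemma preserves_verticals:
  assumes t: "0 < t"
  shows "\<exists>h>0. \<forall>z. F (Some (z, t)) = Some (z, h)"
proof -
  obtain h where h: "0 \<le> h" "F ` horizontal_plane t = horizontal_plane h"
    using image_horizontal_plane[of t] t by auto
  have "\<exists>y. F (Some (z, t)) = Some (y, h) \<and> 0 < h" for z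
  proof -
    obtain y s where ys: "0 < s" "F (Some (z, t)) = Some (y, s)" using interior_to_interior[OF t] .
    have "F (Some (z, t)) \<in> horizontal_plane h" unfolding h(2)[symmetric] by (rule imageI) simp
    then show ?thesis using ys by auto
  qed
  then obtain f where f: "\<And>z. F (Some (z, t)) = Some (f z, h)" and hpos: "0 < h" by metis
  have "surj f"
  proof -
    have "\<exists>x. f x = y" for y
    proof -
      have "Some (y, h) \<in> F ` horizontal_plane t" by (simp add: h(2))
      then obtain q where "q \<in> horizontal_plane t" "F q = Some (y, h)" by (metis imageE)
      then show ?thesis using f by (cases q) auto
    qed
    then show ?thesis by (metis surjI)
  qed
  moreover have "dist (f x) w = dist (f y) w" if "dist x w = dist y w" for w x y
  proof -
    define r where "r = ((dist x w)\<^sup>2 + t\<^sup>2) / (2 * t)"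
    have r: "0 < r" using t by (simp add: r_def add_nonneg_pos)
    obtain r' where r': "0 < r'" "F ` normal_sphere w r = normal_sphere w r'"
      using image_normal_sphere_interior[OF r] .
    have "Some (f v, h) \<in> normal_sphere w r'" if "dist v w = dist x w" for v
    proof -
      have "Some (v, t) \<in> normal_sphere w r"
        unfolding mem_normal_sphere[OF r] using t that by (simp add: r_def flip: dist_norm)
      then show ?thesis using f[of v] r' by (metis imageI)
    qed
    from this[of x] this[of y] that
    have "(dist (f x) w)\<^sup>2 + h\<^sup>2 = 2 * r' * h" "(dist (f y) w)\<^sup>2 + h\<^sup>2 = 2 * r' * h"
      by (simp_all add: mem_normal_sphere[OF r'(1)] dist_norm)
    then have "(dist (f x) w)\<^sup>2 = (dist (f y) w)\<^sup>2" by linarith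
    then show ?thesis by simp
  qed
  ultimately have "f z = z" for z by (rule concentric_circle_map_is_id)
  then show ?thesis using f hpos by auto
qed

text \<open>
  The top \<open>(0, t)\<close> of a normal sphere based at \<open>0\<close> and its points of height \<open>s\<close> have images on one
  normal sphere based at \<open>0\<close>; this yields the functional equation for the heights.
\<close>

lemma eq_id:
  assumes "p \<in> upper_half_space"
  shows "F p = p"
proof -
  obtain \<psi> where pos: "\<And>t. 0 < t \<Longrightarrow> 0 < \<psi> t"
    and \<psi>: "\<And>t z. 0 < t \<Longrightarrow> F (Some (z, t)) = Some (z, \<psi> t)"
    using preserves_verticals by metis
  have "\<psi> s * (\<psi> t - \<psi> s) = s * (t - s)" if st: "0 < s" "s \<le> t" for s t
  proof -
    define r where "r = t / 2"
    have r: "0 < r" using st by (simp add: r_def)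
    obtain r' where r': "0 < r'" "F ` normal_sphere 0 r = normal_sphere 0 r'"
      using image_normal_sphere_interior[OF r] .
    \<comment> \<open>\<open>(z, s)\<close> is a point of height \<open>s\<close> on the sphere with bottom \<open>0\<close> and top \<open>(0, t)\<close>\<close>
    define z where "z = complex_of_real (sqrt (s * (t - s)))"
    have z: "(cmod z)\<^sup>2 = s * (t - s)" using st by (simp add: z_def)
    have "Some (0, t) \<in> normal_sphere 0 r" "Some (z, s) \<in> normal_sphere 0 r"
      unfolding mem_normal_sphere[OF r] using z by (simp_all add: r_def power2_eq_square algebra_simps)
    then have "Some (0, \<psi> t) \<in> normal_sphere 0 r'" "Some (z, \<psi> s) \<in> normal_sphere 0 r'"
      using \<psi>[of t 0] \<psi>[of s z] r'(2) st by (metis imageI order_less_le_trans)+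
    then have "\<psi> t * \<psi> t = 2 * r' * \<psi> t" "s * (t - s) + \<psi> s * \<psi> s = 2 * r' * \<psi> s"
      using z by (simp_all add: mem_normal_sphere[OF r'(1)] power2_eq_square)
    moreover from this(1) have "\<psi> t = 2 * r'" using pos[of t] st by simp
    ultimately show ?thesis by (simp add: algebra_simps)
  qed
  moreover have "\<exists>d>0. \<forall>t. 0 < t \<and> t < d \<longrightarrow> \<psi> t < e" if e: "0 < e" for e
  proof -
    obtain d where d: "0 < d" "\<And>t. 0 < t \<Longrightarrow> t < d \<Longrightarrow> F (Some (0, t)) \<in> Some ` ball 0 e"
      using small_near_origin[OF e] by blast
    have "\<psi> t < e" if "0 < t" "t < d" for t
    proof -
      have "(0 :: complex, \<psi> t) \<in> ball 0 e" using d(2)[OF that] \<psi>[OF that(1), of 0] by auto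
      then show ?thesis by (simp add: norm_prod_def)
    qed
    then show ?thesis using d(1) by blast
  qed
  ultimately have "\<psi> t = t" if "0 < t" for t
    using height_function_is_id[of \<psi> t] pos that by blast
  then have "F (Some (z, t)) = Some (z, t)" if "0 \<le> t" for z t
    using \<psi>[of t z] that by (cases "t = 0") auto
  then show ?thesis using assms by (cases p) auto
qed

end

section \<open>The Poincare extension and its action\<close>

text \<open>
  Any extension \<open>F\<close> of \<open>m\<close>, followed by the inverse extension \<open>G'\<close>, extends the identity and is
  therefore the identity on the closed half-space.
\<close>

lemma poincare_extension_eqI:
  assumes G: "is_poincare_extension m G" and G': "is_poincare_extension m' G'"
    and GG': "\<And>p. G (G' p) = p" and G'G: "\<And>p. G' (G p) = p"
    and p: "p \<in> upper_half_space"
  shows "poincare_extension m p = G p"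
proof -
  have bd: "boundary_point v = boundary_point w \<Longrightarrow> v = w" for v w
    by (cases v; cases w) (auto simp: boundary_point_def)
  have "m' (m w) = w" for w
  proof (rule bd)
    have "boundary_point (m' (m w)) = G' (G (boundary_point w))"
      using G G' by (simp add: is_poincare_extension_def)
    then show "boundary_point (m' (m w)) = boundary_point w" by (simp add: G'G)
  qed
  then have m'm: "m' \<circ> m = (\<lambda>w. w)" by auto
  have unique: "F q = G q" if "is_poincare_extension m F" "q \<in> upper_half_space" for F q
  proof -
    interpret extension_of_identity "G' \<circ> F"
      using is_poincare_extension_comp[OF G' that(1)] by unfold_locales (simp add: m'm)
    have "G' (F q) = q" using eq_id[OF that(2)] by simp
    then show ?thesis by (metis GG')
  qed
  have "poincare_extension m = restrict G upper_half_space"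
    unfolding poincare_extension_def
  proof (rule the_equality)
    show "restrict G upper_half_space \<in> extensional upper_half_space \<and>
        is_poincare_extension m (restrict G upper_half_space)"
      using is_poincare_extension_cong[OF G, of "restrict G upper_half_space"] by simp
    fix F assume "F \<in> extensional upper_half_space \<and> is_poincare_extension m F"
    then show "F = restrict G upper_half_space"
      using unique by (auto intro!: extensionalityI[of _ upper_half_space])
  qed
  then show ?thesis using p by simp
qed

lemma poincare_extension_image_S_sphere:
  assumes "is_poincare_extension m G" "is_poincare_extension m' G'"
    and "\<And>p. G (G' p) = p" "\<And>p. G' (G p) = p"
  shows "poincare_extension m ` S_sphere \<alpha> \<beta> = G ` S_sphere \<alpha> \<beta>"
  using poincare_extension_eqI[OF assms] S_sphere_subset by (intro image_cong) auto

theorem proposition3p2: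
  fixes a b c d \<alpha> \<beta> :: complex and \<Delta> :: real
  assumes "a * d - b * c \<noteq> 0"
    and "\<Delta> = sqrt (cmod (a * d - b * c))"
  shows "poincare_extension (moebius a b c d) ` S_sphere \<alpha> \<beta> =
         S_sphere ((a * \<alpha> + b * \<beta>) / of_real \<Delta>) ((c * \<alpha> + d * \<beta>) / of_real \<Delta>)"
proof (cases "c = 0")
  case True
  then have ad: "a \<noteq> 0" "d \<noteq> 0" using assms by auto
  have "similarity_ext a b d (similarity_ext d (- b) a p) = p" for p
    using similarity_ext_inverse[of d a "- b"] ad by simp
  then have "poincare_extension (moebius a b 0 d) ` S_sphere \<alpha> \<beta> = similarity_ext a b d ` S_sphere \<alpha> \<beta>"
    using ad is_poincare_extension_similarity_ext similarity_ext_inverse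
    by (intro poincare_extension_image_S_sphere[where m' = "moebius d (- b) 0 a"
          and G' = "similarity_ext d (- b) a"]) auto
  then show ?thesis using similarity_ext_S_sphere[OF ad refl] True assms(2) by simp
next
  case False
  \<comment> \<open>\<open>(a z + b) / (c z + d) = q + p / (c z + d)\<close>: an affine map, the inversion and an affine map\<close>
  define q where "q = a / c"
  define p where "p = b - a * d / c"
  have cp: "c * p = - (a * d - b * c)" using False by (simp add: p_def field_simps)
  then have p: "p \<noteq> 0" using assms(1) by auto
  define G where "G = similarity_ext p q 1 \<circ> (inversion_ext \<circ> similarity_ext c d 1)"
  define G' where "G' = similarity_ext 1 (- d) c \<circ> (inversion_ext \<circ> similarity_ext 1 (- q) p)"
  have "moebius a b c d = moebius p q 0 1 \<circ> (moebius 0 1 1 0 \<circ> moebius c d 0 1)"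
  proof
    fix w
    show "moebius a b c d w = (moebius p q 0 1 \<circ> (moebius 0 1 1 0 \<circ> moebius c d 0 1)) w"
    proof (cases w)
      case None
      then show ?thesis using False by (simp add: moebius_def q_def)
    next
      case (Some z)
      define y where "y = c * z + d"
      have "a * z + b = p + q * y" using False by (simp add: p_def q_def y_def field_simps)
      then have "(a * z + b) / y = p / y + q" if "y \<noteq> 0"
        using that by (simp add: add_divide_distrib)
      then show ?thesis using Some by (simp add: moebius_def flip: y_def)
    qed
  qed
  then have G: "is_poincare_extension (moebius a b c d) G"
    using False p unfolding G_def
    by (auto intro!: is_poincare_extension_comp is_poincare_extension_similarity_ext
        is_poincare_extension_inversion_ext)
  have G': "is_poincare_extension (moebius 1 (- d) 0 c \<circ> (moebius 0 1 1 0 \<circ> moebius 1 (- q) 0 p)) G'"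
    using False p unfolding G'_def
    by (auto intro!: is_poincare_extension_comp is_poincare_extension_similarity_ext
        is_poincare_extension_inversion_ext)
  have inv: "similarity_ext u v 1 (similarity_ext 1 (- v) u x) = x"
    "similarity_ext 1 (- v) u (similarity_ext u v 1 x) = x" if "u \<noteq> 0" for u v x
    using similarity_ext_inverse[of 1 u "- v"] similarity_ext_inverse[of u 1 v] that by auto
  define C P where "C = complex_of_real (sqrt (cmod c))" and "P = complex_of_real (sqrt (cmod p))"
  have "cmod c * cmod p = cmod (a * d - b * c)" using cp by (metis norm_minus_cancel norm_mult)
  then have CP: "C * P = of_real \<Delta>"
    by (simp add: C_def P_def assms(2) flip: of_real_mult real_sqrt_mult)
  have "poincare_extension (moebius a b c d) ` S_sphere \<alpha> \<beta> = G ` S_sphere \<alpha> \<beta>"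
    using G G' by (rule poincare_extension_image_S_sphere) (simp_all add: G_def G'_def inv False p)
  also have "\<dots> = similarity_ext p q 1 ` inversion_ext ` similarity_ext c d 1 ` S_sphere \<alpha> \<beta>"
    by (simp only: G_def image_comp)
  also have "\<dots> = S_sphere ((p * (\<beta> / C) + q * ((c * \<alpha> + d * \<beta>) / C)) / P) ((c * \<alpha> + d * \<beta>) / C / P)"
    using similarity_ext_S_sphere[of c 1 C d] similarity_ext_S_sphere[of p 1 P q] False p
    by (simp add: inversion_ext_S_sphere C_def P_def)
  also have "(p * (\<beta> / C) + q * ((c * \<alpha> + d * \<beta>) / C)) / P = (p * \<beta> + q * (c * \<alpha> + d * \<beta>)) / (C * P)"
    by (simp flip: add_divide_distrib)
  also have "p * \<beta> + q * (c * \<alpha> + d * \<beta>) = a * \<alpha> + b * \<beta>"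
    using False by (simp add: p_def q_def field_simps)
  also have "(c * \<alpha> + d * \<beta>) / C / P = (c * \<alpha> + d * \<beta>) / (C * P)"
    by simp
  finally show ?thesis unfolding CP .
qed

end
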